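(* For every $\epsilon>0$ and $D<\omega$ there exist $m=m(\epsilon,D)$ and an $\mathcal{L}$-formula $\varphi(x,y;\overline{z},\overline{w})$ with $|\overline{z}|=2m$ and $|\overline{w}|=m^2$ such that the following holds: for every family $\mathcal{C}$ of subsets of $\mathbb{R}^2$ with $D$-bounded alternation, every $C\in\mathcal{C}$, every $n<\omega$, every $n\times n$ grid $\Gamma=\{(a_i,b_j):i,j<n\}\subseteq\mathbb{R}^2$, and every choice of probability measures $\mu_0$ on $\{a_i:i<n\}$ and $\mu_1$ on $\{b_j:j<n\}$, there exist $2m$ parameters $\overline{c}$ taken from the coordinates of points of $\Gamma$ and $\overline{d}\in\{0,1\}^{m^2}$ such that $$(\mu_0\otimes\mu_1)\bigl(\varphi(\mathbb{R}^2;\overline{c}^\frown\overline{d})\restriction_\Gamma\;\triangle\; C\restriction_\Gamma\bigr)\le\epsilon.$$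
   Context: $\mathcal{L}=\{+,\times,-,0,1,<\}$ is the language of ordered rings, interpreted in the real field; $\varphi(\mathbb{R}^2;\overline{p})=\{(x,y)\in\mathbb{R}^2:\mathbb{R}\models\varphi(x,y;\overline{p})\}$ and $S\restriction_\Gamma=S\cap\Gamma$. The finite sets carry the discrete $\sigma$-algebra. A set $S\subseteq\mathbb{R}^2$ has at most $D$ alternations along an axis-parallel line $L$ if there is no sequence $p_0<\dots<p_{D+1}$ of points on $L$ such that for each $t\le D$ exactly one of $p_t,p_{t+1}$ lies in $S$; a family has $D$-bounded alternation if none of its elements has more than $D$ alternations along any axis-parallel line. *)

theory Defs
  imports "HOL-Probability.Probability"
begin

text \<open>Variables are named by natural numbers; the subtraction symbol is binary.\<close>

datatype or_term =
    Var nat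
  | Zero
  | One
  | Add or_term or_term
  | Sub or_term or_term
  | Mul or_term or_term

datatype or_formula =
    Eq or_term or_term
  | Less or_term or_term
  | Neg or_formula
  | Conj or_formula or_formula
  | Exi nat or_formula

primrec term_vars :: "or_term \<Rightarrow> nat set" where
  "term_vars (Var i) = {i}"
| "term_vars Zero = {}"
| "term_vars One = {}"
| "term_vars (Add s t) = term_vars s \<union> term_vars t"
| "term_vars (Sub s t) = term_vars s \<union> term_vars t"
| "term_vars (Mul s t) = term_vars s \<union> term_vars t"

primrec free_vars :: "or_formula \<Rightarrow> nat set" where
  "free_vars (Eq s t) = term_vars s \<union> term_vars t"
| "free_vars (Less s t) = term_vars s \<union> term_vars t"
| "free_vars (Neg \<phi>) = free_vars \<phi>"
| "free_vars (Conj \<phi> \<psi>) = free_vars \<phi> \<union> free_vars \<psi>"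
| "free_vars (Exi i \<phi>) = free_vars \<phi> - {i}"

primrec term_val :: "(nat \<Rightarrow> real) \<Rightarrow> or_term \<Rightarrow> real" where
  "term_val v (Var i) = v i"
| "term_val v Zero = 0"
| "term_val v One = 1"
| "term_val v (Add s t) = term_val v s + term_val v t"
| "term_val v (Sub s t) = term_val v s - term_val v t"
| "term_val v (Mul s t) = term_val v s * term_val v t"

primrec sat :: "(nat \<Rightarrow> real) \<Rightarrow> or_formula \<Rightarrow> bool" where
  "sat v (Eq s t) \<longleftrightarrow> term_val v s = term_val v t"
| "sat v (Less s t) \<longleftrightarrow> term_val v s < term_val v t"
| "sat v (Neg \<phi>) \<longleftrightarrow> \<not> sat v \<phi>"
| "sat v (Conj \<phi> \<psi>) \<longleftrightarrow> sat v \<phi> \<and> sat v \<psi>"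
| "sat v (Exi i \<phi>) \<longleftrightarrow> (\<exists>r. sat (v(i := r)) \<phi>)"

text \<open>
  The tuple of variables of \<open>\<phi>(x, y; p)\<close> is \<open>Var 0, Var 1, Var 2, \<dots>\<close>, in this order. Variables
  beyond the end of the tuple are sent to the dummy value 0, which is irrelevant whenever
  \<open>free_vars \<phi> \<subseteq> {..<2 + length ps}\<close>.
\<close>

definition tuple_val :: "real list \<Rightarrow> nat \<Rightarrow> real" where
  "tuple_val xs i = (if i < length xs then xs ! i else 0)"

definition defined_set :: "or_formula \<Rightarrow> real list \<Rightarrow> (real \<times> real) set" where
  "defined_set \<phi> ps = {(x, y). sat (tuple_val (x # y # ps)) \<phi>}"

definition axis_parallel_line :: "(real \<times> real) set \<Rightarrow> bool" where
  "axis_parallel_line L \<longleftrightarrow> (\<exists>r. L = {r} \<times> UNIV \<or> L = UNIV \<times> {r})"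

text \<open>
  The order on \<^typ>\<open>real \<times> real\<close> is the componentwise one, which on an axis-parallel line is the
  usual linear order of the non-constant coordinate.
\<close>

definition at_most_alternations :: "nat \<Rightarrow> (real \<times> real) set \<Rightarrow> (real \<times> real) set \<Rightarrow> bool" where
  "at_most_alternations D S L \<longleftrightarrow>
     \<not> (\<exists>p :: nat \<Rightarrow> real \<times> real.
          (\<forall>t\<le>D + 1. p t \<in> L) \<and>
          (\<forall>t\<le>D. p t < p (t + 1)) \<and>
          (\<forall>t\<le>D. (p t \<in> S) \<noteq> (p (t + 1) \<in> S)))"

definition bounded_alternation :: "nat \<Rightarrow> (real \<times> real) set set \<Rightarrow> bool" where
  "bounded_alternation D \<C> \<longleftrightarrow>
     (\<forall>S\<in>\<C>. \<forall>L. axis_parallel_line L \<longrightarrow> at_most_alternations D S L)"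

definition grid :: "nat \<Rightarrow> (nat \<Rightarrow> real) \<Rightarrow> (nat \<Rightarrow> real) \<Rightarrow> (real \<times> real) set" where
  "grid n a b = {(a i, b j) | i j. i < n \<and> j < n}"

definition discrete_prob_on :: "'a set \<Rightarrow> 'a measure \<Rightarrow> bool" where
  "discrete_prob_on A \<mu> \<longleftrightarrow> prob_space \<mu> \<and> space \<mu> = A \<and> sets \<mu> = Pow A"

end

theory Submission
  imports Defs
begin

text \<open>
  Cut each side of the grid, according to the distribution function of its measure, into boundedly
  many intervals, each of which is a single point or has weight at most \<open>1 / N\<close>, and round
  every coordinate down to the left end of its interval. A line meets at most \<open>D\<close> intervals on which
  the membership in \<open>C\<close> of a point and of its rounding can differ, and these are not single points.
  So by Fubini rounding one coordinate changes \<open>C\<close> on a set of measure at most \<open>D / N\<close>, and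
  rounding both on a set of measure at most \<open>2 D / N\<close>. The rounded set is determined by the left
  end points and by the \<open>m\<^sup>2\<close> truth values of \<open>C\<close> at pairs of them.
\<close>

section \<open>Rounding down along one axis\<close>

definition floor_in :: "'a::linorder set \<Rightarrow> 'a \<Rightarrow> 'a" where
  "floor_in R x = Max {r \<in> R. r \<le> x}"

text \<open>The second hypothesis keeps \<open>Max\<close> off the empty set. The right-hand side
  uses only comparisons with elements of \<open>R\<close>, so it can later be turned into a
  formula.\<close>

lemma floor_in_eq_iff:
  assumes "finite R" "\<exists>r\<in>R. r \<le> x"
  shows "floor_in R x = t \<longleftrightarrow> t \<in> R \<and> t \<le> x \<and> (\<forall>r\<in>R. r \<le> x \<longrightarrow> r \<le> t)"
  unfolding floor_in_def using assms by (subst Max_eq_iff) auto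

text \<open>The intervals from \<open>t\<close> to \<open>X t\<close> are disjoint, and each
  contributes one change. The induction adds the largest left end \<open>b\<close>: as
  \<open>P b\<close> and \<open>P (X b)\<close> differ, at least one of them differs from the value
  at the last point chosen so far. The bound on the last point in the conclusion serves the
  induction: it keeps that point to the left of the next interval.\<close>

lemma alternating_sequence:
  fixes T :: "'a::linorder set"
  assumes "finite T" "T \<noteq> {}"
    and "\<And>t. t \<in> T \<Longrightarrow> t < X t" "\<And>t. t \<in> T \<Longrightarrow> P t \<noteq> P (X t)"
    and "\<And>t u. t \<in> T \<Longrightarrow> u \<in> T \<Longrightarrow> t < u \<Longrightarrow> X t < u"
  shows "\<exists>p. (\<forall>i<card T. p i < p (Suc i) \<and> P (p i) \<noteq> P (p (Suc i))) \<and> (\<exists>t\<in>T. p (card T) \<le> X t)"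
  using assms
proof (induction T rule: finite_linorder_max_induct)
  case empty
  then show ?case by simp
next
  case (insert b A)
  show ?case
  proof (cases "A = {}")
    case True
    then show ?thesis
      using insert.prems by (intro exI[of _ "\<lambda>i. if i = 0 then b else X b"]) auto
  next
    case False
    then obtain p t where p: "\<forall>i<card A. p i < p (Suc i) \<and> P (p i) \<noteq> P (p (Suc i))"
      and t: "t \<in> A" "p (card A) \<le> X t"
      using insert by fastforce
    have "X t < b" "b < X b" "P b \<noteq> P (X b)" using insert t by auto
    then have "p (card A) < b" "p (card A) < X b" "P (p (card A)) \<noteq> P b \<or> P (p (card A)) \<noteq> P (X b)"
      using t by auto
    then obtain q where q: "p (card A) < q" "P (p (card A)) \<noteq> P q" "q \<le> X b"
      using \<open>b < X b\<close> by (metis less_imp_le order_refl)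
    moreover have "b \<notin> A" using insert by auto
    ultimately show ?thesis
      using p insert.hyps
      by (intro exI[of _ "\<lambda>i. if i \<le> card A then p i else q"]) (auto simp: less_Suc_eq)
  qed
qed

text \<open>\<open>R\<close> collects the least and the greatest point of each level set of the
  distribution function, rounded down to multiples of \<open>1 / N\<close>. The greatest point of a
  level is a cell of its own, and the remaining points, if any, form one other cell. This isolates a
  possible heavy atom: a cell with more than one point omits the greatest point of its level, so its
  weight is bounded by an increase of the distribution function inside one level.\<close>

lemma discrete_prob_on_net:
  fixes A :: "real set" and N :: nat
  assumes \<mu>: "discrete_prob_on A \<mu>" and A: "finite A" and N: "N > 0"
  obtains R where "R \<subseteq> A" "card R \<le> 2 * (N + 1)" "\<And>x. x \<in> A \<Longrightarrow> \<exists>r\<in>R. r \<le> x"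
    "\<And>x. x \<in> A \<Longrightarrow> floor_in R x \<noteq> x \<Longrightarrow>
       measure \<mu> {y \<in> A. floor_in R y = floor_in R x} \<le> 1 / real N"
proof -
  interpret prob_space \<mu> using \<mu> by (simp add: discrete_prob_on_def)
  have sets: "S \<subseteq> A \<Longrightarrow> S \<in> sets \<mu>" for S using \<mu> by (simp add: discrete_prob_on_def)
  \<comment> \<open>The inequality is strict, so for \<open>t\<close> below \<open>M\<close> the
    difference \<open>F M - F t\<close> counts the points from \<open>t\<close> on but not
    \<open>M\<close> itself.\<close>
  define F where "F x = prob {y \<in> A. y < x}" for x
  define g where "g x = nat \<lfloor>real N * F x\<rfloor>" for x
  have F_mono: "F x \<le> F y" if "x \<le> y" for x y
    unfolding F_def using that by (intro finite_measure_mono sets) auto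
  have g_mono: "g x \<le> g y" if "x \<le> y" for x y
    unfolding g_def using F_mono[OF that] by (intro nat_mono floor_mono mult_left_mono) auto
  have F01: "0 \<le> F x" "F x \<le> 1" for x unfolding F_def by auto
  have "real N * F x \<le> real N" for x using F01[of x] by (simp add: mult_left_le)
  then have g_le: "g x \<le> N" for x
    unfolding g_def by (metis floor_mono floor_of_nat nat_int nat_mono)
  have F_close: "F y - F x \<le> 1 / real N" if "g x = g y" for x y
  proof -
    have "\<lfloor>real N * F x\<rfloor> = \<lfloor>real N * F y\<rfloor>"
      using that F01 unfolding g_def by (simp add: nat_eq_iff2)
    then have "real N * F y - real N * F x \<le> 1" by linarith
    then show ?thesis using N by (simp add: field_simps)
  qed
  define K where "K k = {y \<in> A. g y = k}" for k
  have finK: "finite (K k)" for k using A by (simp add: K_def)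
  have inK: "x \<in> K (g x)" if "x \<in> A" for x using that by (simp add: K_def)
  define R where "R = (\<lambda>k. Min (K k)) ` g ` A \<union> (\<lambda>k. Max (K k)) ` g ` A"
  have MinK: "Min (K (g x)) \<in> K (g x)" "Min (K (g x)) \<le> x" "Min (K (g x)) \<in> R" if "x \<in> A" for x
    using that inK[OF that] finK by (auto simp: R_def intro!: Min_in)
  have MaxK: "Max (K (g x)) \<in> K (g x)" "x \<le> Max (K (g x))" "Max (K (g x)) \<in> R" if "x \<in> A" for x
    using that inK[OF that] finK by (auto simp: R_def intro!: Max_in)
  have R_ex: "\<exists>r\<in>R. r \<le> x" if "x \<in> A" for x using MinK[OF that] by auto
  have finR: "finite R" using A by (simp add: R_def)
  have RA: "R \<subseteq> A" using MinK(1) MaxK(1) by (auto simp: R_def K_def)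
  \<comment> \<open>The levels are among \<open>0, ..., N\<close>, and each contributes at most two
    points.\<close>
  have "card (g ` A) \<le> card {..N}" using g_le by (intro card_mono) auto
  then have "card R \<le> 2 * (N + 1)"
    unfolding R_def using card_Un_le card_image_le[OF finite_imageI[OF A]]
    by (smt (verit) add_mono card_atMost mult_2 order_trans Suc_eq_plus1)
  moreover have "prob {y \<in> A. floor_in R y = floor_in R x} \<le> 1 / real N"
    if x: "x \<in> A" "floor_in R x \<noteq> x" for x
  proof -
    define t where "t = floor_in R x"
    have fl: "t \<in> R \<and> t \<le> y \<and> (\<forall>r\<in>R. r \<le> y \<longrightarrow> r \<le> t)" if "y \<in> A" "floor_in R y = t" for y
      using that floor_in_eq_iff[OF finR R_ex[OF that(1)]] by blast
    \<comment> \<open>\<open>R\<close> contains the least point of the level of \<open>y\<close>, so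
      rounding down never leaves that level.\<close>
    have gt: "g t = g y" if "y \<in> A" "floor_in R y = t" for y
    proof (rule antisym)
      show "g t \<le> g y" using fl[OF that] by (intro g_mono) auto
      have "g y = g (Min (K (g y)))" using MinK(1)[OF that(1)] by (simp add: K_def)
      also have "\<dots> \<le> g t" using fl[OF that] MinK[OF that(1)] by (intro g_mono) auto
      finally show "g y \<le> g t" .
    qed
    define M where "M = Max (K (g x))"
    have "t < x" using fl[OF x(1)] x t_def by auto
    then have "t < M" using MaxK(2)[OF x(1)] M_def by auto
    \<comment> \<open>\<open>M\<close> lies in \<open>R\<close> and is therefore its own rounding,
      whereas the cell in question rounds to \<open>t < M\<close>.\<close>
    have less_M: "y < M" if y: "y \<in> A" "floor_in R y = t" for y
    proof -
      have "g y = g x" using gt[OF y] gt[OF x(1)] t_def by auto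
      then have "y \<le> M" "M \<in> R" using MaxK[OF y(1)] M_def by auto
      moreover have "y \<noteq> M" using fl[OF y] \<open>M \<in> R\<close> \<open>t < M\<close> by auto
      ultimately show ?thesis by auto
    qed
    \<comment> \<open>The two sets are disjoint and lie strictly below \<open>M\<close>, so the cell
      weighs at most \<open>F M - F t\<close>.\<close>
    have "F t + prob {y \<in> A. floor_in R y = t} = prob ({y \<in> A. y < t} \<union> {y \<in> A. floor_in R y = t})"
      unfolding F_def using fl by (intro finite_measure_Union[symmetric] sets) force+
    also have "\<dots> \<le> F M"
      unfolding F_def using less_M \<open>t < M\<close> by (intro finite_measure_mono sets) auto
    moreover have "g t = g M"
      using gt[OF x(1)] MaxK(1)[OF x(1)] by (simp add: t_def M_def K_def)
    ultimately show ?thesis using F_close[of t M] by (simp add: t_def)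
  qed
  ultimately show ?thesis using that RA R_ex by blast
qed

text \<open>\<open>T\<close> consists of the left ends of the cells in which rounding goes wrong
  somewhere. A wrongly rounded point chosen in each of them, paired with its left end, feeds
  \<open>alternating_sequence\<close>; more than \<open>D\<close> such cells would give the
  \<open>D + 1\<close> changes that \<open>alt\<close> forbids.\<close>

lemma rounding_error_le:
  fixes A :: "real set" and N :: nat
  assumes \<mu>: "discrete_prob_on A \<mu>" and A: "finite A" and RA: "R \<subseteq> A"
    and R_ex: "\<And>x. x \<in> A \<Longrightarrow> \<exists>r\<in>R. r \<le> x"
    and cell: "\<And>x. x \<in> A \<Longrightarrow> floor_in R x \<noteq> x \<Longrightarrow>
       measure \<mu> {y \<in> A. floor_in R y = floor_in R x} \<le> 1 / real N"
    and alt: "\<not> (\<exists>p :: nat \<Rightarrow> real. \<forall>t\<le>D. p t < p (Suc t) \<and> P (p t) \<noteq> P (p (Suc t)))"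
  shows "measure \<mu> {x \<in> A. P x \<noteq> P (floor_in R x)} \<le> real D / real N"
proof -
  interpret prob_space \<mu> using \<mu> by (simp add: discrete_prob_on_def)
  have sets: "S \<subseteq> A \<Longrightarrow> S \<in> sets \<mu>" for S using \<mu> by (simp add: discrete_prob_on_def)
  have finR: "finite R" using A RA finite_subset by blast
  define B where "B = {x \<in> A. P x \<noteq> P (floor_in R x)}"
  define T where "T = floor_in R ` B"
  have finT: "finite T" using A by (simp add: T_def B_def)
  have fl: "floor_in R x \<in> R" "floor_in R x \<le> x" "\<And>r. r \<in> R \<Longrightarrow> r \<le> x \<Longrightarrow> r \<le> floor_in R x"
    if "x \<in> A" for x
    using floor_in_eq_iff[OF finR R_ex[OF that], of "floor_in R x"] by auto
  have cardT: "card T \<le> D"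
  proof (rule ccontr)
    assume D: "\<not> card T \<le> D"
    then have "T \<noteq> {}" by auto
    have "\<forall>t\<in>T. \<exists>x\<in>B. floor_in R x = t" by (auto simp: T_def)
    then obtain X where X: "\<And>t. t \<in> T \<Longrightarrow> X t \<in> B" "\<And>t. t \<in> T \<Longrightarrow> floor_in R (X t) = t"
      by metis
    have XA: "X t \<in> A" if "t \<in> T" for t using X(1)[OF that] by (simp add: B_def)
    have ne: "P t \<noteq> P (X t)" if "t \<in> T" for t using X[OF that] by (auto simp: B_def)
    have lt: "t < X t" if "t \<in> T" for t
      using fl(2)[OF XA[OF that]] X(2)[OF that] ne[OF that] by (cases "t = X t") auto
    \<comment> \<open>Otherwise \<open>u\<close>, an element of \<open>R\<close> not above
      \<open>X t\<close>, would be at most the rounding \<open>t\<close> of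
      \<open>X t\<close>.\<close>
    have sep: "X t < u" if "t \<in> T" "u \<in> T" "t < u" for t u
      using fl(3)[OF XA[OF that(1)], of u] fl(1)[OF XA[OF that(2)]] X(2) that by force
    obtain p where "\<forall>i<card T. p i < p (Suc i) \<and> P (p i) \<noteq> P (p (Suc i))"
      using alternating_sequence[OF finT \<open>T \<noteq> {}\<close> lt, where P = P] ne sep by blast
    then show False using alt D by (meson le_less_trans not_le)
  qed
  have "B \<subseteq> (\<Union>t\<in>T. {y \<in> A. floor_in R y = t})" by (auto simp: T_def B_def)
  then have "prob B \<le> prob (\<Union>t\<in>T. {y \<in> A. floor_in R y = t})"
    by (intro finite_measure_mono sets) auto
  also have "\<dots> \<le> (\<Sum>t\<in>T. prob {y \<in> A. floor_in R y = t})"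
    using finT by (intro finite_measure_subadditive_finite) (auto intro: sets)
  also have "\<dots> \<le> (\<Sum>t\<in>T. 1 / real N)"
  proof (rule sum_mono)
    fix t assume "t \<in> T"
    then obtain x where x: "x \<in> B" "t = floor_in R x" by (auto simp: T_def)
    \<comment> \<open>A wrongly rounded point differs from its rounding, so its cell is one of those
      to which \<open>cell\<close> applies.\<close>
    then have "x \<in> A" "floor_in R x \<noteq> x" by (force simp: B_def)+
    then show "prob {y \<in> A. floor_in R y = t} \<le> 1 / real N" using cell x by simp
  qed
  also have "\<dots> \<le> real D / real N" using cardT by (simp add: divide_right_mono)
  finally show ?thesis by (simp add: B_def)
qed

section \<open>Product measures bounded through slices\<close>

lemma sets_pair_discrete:
  assumes "discrete_prob_on A \<mu>" "discrete_prob_on B \<nu>" "finite A" "finite B" "S \<subseteq> A \<times> B"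
  shows "S \<in> sets (\<mu> \<Otimes>\<^sub>M \<nu>)"
proof -
  have "finite S" using assms finite_subset by blast
  moreover have "{s} \<in> sets (\<mu> \<Otimes>\<^sub>M \<nu>)" if "s \<in> S" for s
  proof -
    have "{fst s} \<times> {snd s} \<in> sets (\<mu> \<Otimes>\<^sub>M \<nu>)"
      using assms that by (intro pair_measureI) (auto simp: discrete_prob_on_def)
    then show ?thesis by simp
  qed
  ultimately have "(\<Union>s\<in>S. {s}) \<in> sets (\<mu> \<Otimes>\<^sub>M \<nu>)" by (intro sets.finite_UN) auto
  then show ?thesis by simp
qed

text \<open>The slice bound is integrated against a probability measure. The next lemma slices in
  the other direction; both are needed because the two coordinates are rounded one at a
  time.\<close>

lemma measure_pair_le_of_slices:
  assumes "prob_space \<mu>" "prob_space \<nu>" "S \<in> sets (\<mu> \<Otimes>\<^sub>M \<nu>)" "0 \<le> K"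
    and slice: "\<And>x. x \<in> space \<mu> \<Longrightarrow> measure \<nu> (Pair x -` S) \<le> K"
  shows "measure (\<mu> \<Otimes>\<^sub>M \<nu>) S \<le> K"
proof -
  interpret M: prob_space \<mu> by fact
  interpret N: prob_space \<nu> by fact
  interpret P: pair_prob_space \<mu> \<nu> ..
  have "emeasure (\<mu> \<Otimes>\<^sub>M \<nu>) S = (\<integral>\<^sup>+x. emeasure \<nu> (Pair x -` S) \<partial>\<mu>)"
    using assms by (intro N.emeasure_pair_measure_alt) auto
  also have "\<dots> \<le> (\<integral>\<^sup>+x. ennreal K \<partial>\<mu>)"
    using slice by (intro nn_integral_mono) (auto simp: N.emeasure_eq_measure intro: ennreal_leI)
  also have "\<dots> = ennreal K" by (simp add: M.emeasure_space_1)
  finally show ?thesis using \<open>0 \<le> K\<close> by (simp add: P.P.emeasure_eq_measure)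
qed

lemma measure_pair_le_of_slices2:
  assumes "prob_space \<mu>" "prob_space \<nu>" "S \<in> sets (\<mu> \<Otimes>\<^sub>M \<nu>)" "0 \<le> K"
    and slice: "\<And>y. y \<in> space \<nu> \<Longrightarrow> measure \<mu> ((\<lambda>x. (x, y)) -` S) \<le> K"
  shows "measure (\<mu> \<Otimes>\<^sub>M \<nu>) S \<le> K"
proof -
  interpret M: prob_space \<mu> by fact
  interpret N: prob_space \<nu> by fact
  interpret P: pair_prob_space \<mu> \<nu> ..
  have "emeasure (\<mu> \<Otimes>\<^sub>M \<nu>) S = (\<integral>\<^sup>+y. emeasure \<mu> ((\<lambda>x. (x, y)) -` S) \<partial>\<nu>)"
    using assms by (intro P.emeasure_pair_measure_alt2) auto
  also have "\<dots> \<le> (\<integral>\<^sup>+y. ennreal K \<partial>\<nu>)"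
    using slice by (intro nn_integral_mono) (auto simp: M.emeasure_eq_measure intro: ennreal_leI)
  also have "\<dots> = ennreal K" by (simp add: N.emeasure_space_1)
  finally show ?thesis using \<open>0 \<le> K\<close> by (simp add: P.P.emeasure_eq_measure)
qed

section \<open>The formula and the set it defines\<close>

definition conjs :: "or_formula list \<Rightarrow> or_formula" where
  "conjs fs = foldr Conj fs (Eq Zero Zero)"

definition disjs :: "or_formula list \<Rightarrow> or_formula" where
  "disjs fs = Neg (conjs (map Neg fs))"

lemma sat_conjs: "sat v (conjs fs) \<longleftrightarrow> (\<forall>f\<in>set fs. sat v f)"
  by (induction fs) (auto simp: conjs_def)

lemma free_vars_conjs: "free_vars (conjs fs) = (\<Union>f\<in>set fs. free_vars f)"
  by (induction fs) (auto simp: conjs_def)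

lemma sat_disjs: "sat v (disjs fs) \<longleftrightarrow> (\<exists>f\<in>set fs. sat v f)"
  by (simp add: disjs_def sat_conjs)

lemma free_vars_disjs: "free_vars (disjs fs) = (\<Union>f\<in>set fs. free_vars f)"
  by (simp add: disjs_def free_vars_conjs)

text \<open>\<open>u\<close> is the variable to be rounded, \<open>s\<close> the first index of a
  block of \<open>m\<close> parameters, and \<open>i\<close> the position of the candidate in that
  block. The relation \<le> is expressed as a negated \<open>Less\<close> with its arguments
  swapped.\<close>

definition floor_formula :: "nat \<Rightarrow> nat \<Rightarrow> nat \<Rightarrow> nat \<Rightarrow> or_formula" where
  "floor_formula m s u i = Conj (Neg (Less (Var u) (Var (s + i))))
     (conjs (map (\<lambda>k. Neg (Conj (Less (Var (s + i)) (Var (s + k)))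
                               (Neg (Less (Var u) (Var (s + k)))))) [0..<m]))"

lemma sat_floor_formula:
  assumes "i < m" "\<exists>k<m. v (s + k) \<le> v u"
  shows "sat v (floor_formula m s u i) \<longleftrightarrow> floor_in ((\<lambda>k. v (s + k)) ` {..<m}) (v u) = v (s + i)"
  using assms
  by (subst floor_in_eq_iff) (auto simp: floor_formula_def sat_conjs not_less)

text \<open>Variables 0 and 1 hold the point, the next \<open>m\<close> the left ends on the first
  axis, the next \<open>m\<close> those on the second, and the last \<open>m * m\<close> the truth
  values of the cells, stored row by row.\<close>

definition block_formula :: "nat \<Rightarrow> or_formula" where
  "block_formula m = disjs (concat (map (\<lambda>i. map (\<lambda>j.
     Conj (Conj (floor_formula m 2 0 i) (floor_formula m (2 + m) 1 j))
          (Eq (Var (2 + 2 * m + (i * m + j))) One)) [0..<m]) [0..<m]))"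

lemma block_index_less: "i * m + j < m * m" if "i < m" "j < m" for i j m :: nat
proof -
  have "i * m + j < Suc i * m" using that by simp
  also have "\<dots> \<le> m * m" using that by (intro mult_right_mono) auto
  finally show ?thesis .
qed

lemma free_vars_block_formula: "free_vars (block_formula m) \<subseteq> {..<2 + 2 * m + m\<^sup>2}"
proof -
  have "i * m + j < m\<^sup>2" if "i < m" "j < m" for i j
    using block_index_less[OF that] by (simp add: power2_eq_square)
  then show ?thesis
    by (auto simp: block_formula_def free_vars_disjs free_vars_conjs floor_formula_def)
qed

lemma sat_block_formula:
  assumes "\<exists>k<m. v (2 + k) \<le> v 0" "\<exists>k<m. v (2 + m + k) \<le> v 1"
  shows "sat v (block_formula m) \<longleftrightarrow> (\<exists>i<m. \<exists>j<m.
     floor_in ((\<lambda>k. v (2 + k)) ` {..<m}) (v 0) = v (2 + i) \<and>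
     floor_in ((\<lambda>k. v (2 + m + k)) ` {..<m}) (v 1) = v (2 + m + j) \<and>
     v (2 + 2 * m + (i * m + j)) = 1)"
proof -
  have "sat v (block_formula m) \<longleftrightarrow> (\<exists>i<m. \<exists>j<m.
     sat v (floor_formula m 2 0 i) \<and> sat v (floor_formula m (2 + m) 1 j) \<and>
     v (2 + 2 * m + (i * m + j)) = 1)"
    by (simp add: block_formula_def sat_disjs) (force simp: Bex_def)
  then show ?thesis
    using sat_floor_formula[OF _ assms(1)] sat_floor_formula[OF _ assms(2)] by auto
qed

text \<open>\<open>div\<close> and \<open>mod\<close> decode the row-by-row index. The lists may
  have repeated entries, so several index pairs can name one cell; their truth values agree because
  each depends only on the entries.\<close>

lemma defined_set_block_formula:
  assumes len: "length c1 = m" "length c2 = m"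
    and d: "d = map (\<lambda>k. if (c1 ! (k div m), c2 ! (k mod m)) \<in> C then 1 else 0) [0..<m\<^sup>2]"
    and x: "\<exists>r\<in>set c1. r \<le> x" and y: "\<exists>r\<in>set c2. r \<le> y"
  shows "(x, y) \<in> defined_set (block_formula m) ((c1 @ c2) @ d) \<longleftrightarrow>
    (floor_in (set c1) x, floor_in (set c2) y) \<in> C"
proof -
  define v where "v = tuple_val (x # y # (c1 @ c2) @ d)"
  have v: "v 0 = x" "v 1 = y" by (simp_all add: v_def tuple_val_def)
  have v1: "v (2 + i) = c1 ! i" if "i < m" for i
    using that len by (simp add: v_def tuple_val_def nth_append)
  have v2: "v (2 + m + j) = c2 ! j" if "j < m" for j
    using that len by (simp add: v_def tuple_val_def nth_append)
  have v3: "v (2 + 2 * m + (i * m + j)) = (if (c1 ! i, c2 ! j) \<in> C then 1 else 0)"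
    if "i < m" "j < m" for i j
    using that len block_index_less[OF that]
    by (simp add: v_def tuple_val_def nth_append d power2_eq_square)
  have R1: "(\<lambda>k. v (2 + k)) ` {..<m} = set c1"
    using v1 len by (auto simp: set_conv_nth image_iff)
  have R2: "(\<lambda>k. v (2 + m + k)) ` {..<m} = set c2"
    using v2 len by (auto simp: set_conv_nth image_iff)
  have ex1: "\<exists>k<m. v (2 + k) \<le> v 0" using x unfolding R1[symmetric] v by blast
  have ex2: "\<exists>k<m. v (2 + m + k) \<le> v 1" using y unfolding R2[symmetric] v by blast
  \<comment> \<open>Some index pair names the rounded point, so the disjunction cannot fail merely
    for want of a matching pair.\<close>
  have "floor_in (set c1) x \<in> set c1" "floor_in (set c2) y \<in> set c2"
    using floor_in_eq_iff[of "set c1" x "floor_in (set c1) x"] x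
      floor_in_eq_iff[of "set c2" y "floor_in (set c2) y"] y by auto
  then have "\<exists>i<m. floor_in (set c1) x = c1 ! i" "\<exists>j<m. floor_in (set c2) y = c2 ! j"
    using len by (auto simp: in_set_conv_nth)
  moreover have "(x, y) \<in> defined_set (block_formula m) ((c1 @ c2) @ d) \<longleftrightarrow> sat v (block_formula m)"
    by (simp add: defined_set_def v_def)
  moreover have "\<dots> \<longleftrightarrow> (\<exists>i<m. \<exists>j<m. floor_in (set c1) x = c1 ! i \<and>
      floor_in (set c2) y = c2 ! j \<and> (c1 ! i, c2 ! j) \<in> C)"
    unfolding sat_block_formula[OF ex1 ex2] R1 R2 v
    by (smt (verit, best) v1 v2 v3)
  ultimately show ?thesis by metis
qed

section \<open>From the axes to the grid\<close>

lemma ex_list_of_length: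
  assumes "finite R" "R \<noteq> {}" "card R \<le> m"
  obtains xs where "set xs = R" "length xs = m"
proof -
  obtain ys where ys: "set ys = R" "length ys = card R"
    using finite_distinct_list[OF assms(1)] distinct_card by metis
  obtain r where "r \<in> R" using assms by blast
  \<comment> \<open>The formula expects exactly \<open>m\<close> parameters per axis; repeating one
    element fills the list without changing its set.\<close>
  then show ?thesis
    using that[of "ys @ replicate (m - card R) r"] ys assms by (auto simp: set_replicate_conv_if insert_absorb)
qed

text \<open>With one coordinate fixed, strict componentwise increase is strict increase of the other
  coordinate. This yields the hypothesis \<open>alt\<close> of
  \<open>rounding_error_le\<close>.\<close>

lemma no_alternating_sequence_vertical:
  assumes "bounded_alternation D \<C>" "C \<in> \<C>"
  shows "\<not> (\<exists>q :: nat \<Rightarrow> real. \<forall>t\<le>D. q t < q (Suc t) \<and> ((x, q t) \<in> C) \<noteq> ((x, q (Suc t)) \<in> C))"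
proof
  assume "\<exists>q :: nat \<Rightarrow> real. \<forall>t\<le>D. q t < q (Suc t) \<and> ((x, q t) \<in> C) \<noteq> ((x, q (Suc t)) \<in> C)"
  then obtain q :: "nat \<Rightarrow> real"
    where q: "\<forall>t\<le>D. q t < q (Suc t) \<and> ((x, q t) \<in> C) \<noteq> ((x, q (Suc t)) \<in> C)" ..
  have "at_most_alternations D C ({x} \<times> UNIV)"
    using assms unfolding bounded_alternation_def axis_parallel_line_def by blast
  then show False
    unfolding at_most_alternations_def using q
    by (elim notE, intro exI[of _ "\<lambda>t. (x, q t)"]) (auto simp: less_le less_eq_prod_def)
qed

lemma no_alternating_sequence_horizontal:
  assumes "bounded_alternation D \<C>" "C \<in> \<C>"
  shows "\<not> (\<exists>q :: nat \<Rightarrow> real. \<forall>t\<le>D. q t < q (Suc t) \<and> ((q t, y) \<in> C) \<noteq> ((q (Suc t), y) \<in> C))"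
proof
  assume "\<exists>q :: nat \<Rightarrow> real. \<forall>t\<le>D. q t < q (Suc t) \<and> ((q t, y) \<in> C) \<noteq> ((q (Suc t), y) \<in> C)"
  then obtain q :: "nat \<Rightarrow> real"
    where q: "\<forall>t\<le>D. q t < q (Suc t) \<and> ((q t, y) \<in> C) \<noteq> ((q (Suc t), y) \<in> C)" ..
  have "at_most_alternations D C (UNIV \<times> {y})"
    using assms unfolding bounded_alternation_def axis_parallel_line_def by blast
  then show False
    unfolding at_most_alternations_def using q
    by (elim notE, intro exI[of _ "\<lambda>t. (q t, y)"]) (auto simp: less_le less_eq_prod_def)
qed

lemma block_formula_approximates:
  fixes A B :: "real set" and N :: nat
  assumes bdd: "bounded_alternation D \<C>" "C \<in> \<C>"
    and A: "finite A" "discrete_prob_on A \<mu>" and B: "finite B" "discrete_prob_on B \<nu>"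
    and N: "N > 0" and m: "m = 2 * (N + 1)"
  shows "\<exists>c d. length c = 2 * m \<and> set c \<subseteq> A \<union> B \<and> length d = m\<^sup>2 \<and> set d \<subseteq> {0, 1} \<and>
    measure (\<mu> \<Otimes>\<^sub>M \<nu>) (sym_diff (defined_set (block_formula m) (c @ d) \<inter> A \<times> B) (C \<inter> A \<times> B))
      \<le> 2 * real D / real N"
proof -
  have \<mu>: "prob_space \<mu>" "space \<mu> = A" and \<nu>: "prob_space \<nu>" "space \<nu> = B"
    using A B by (auto simp: discrete_prob_on_def)
  interpret M: prob_space \<mu> by fact
  interpret N: prob_space \<nu> by fact
  interpret P: pair_prob_space \<mu> \<nu> ..
  obtain R where R: "R \<subseteq> A" "card R \<le> m" "\<And>x. x \<in> A \<Longrightarrow> \<exists>r\<in>R. r \<le> x"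
    "\<And>x. x \<in> A \<Longrightarrow> floor_in R x \<noteq> x \<Longrightarrow>
       measure \<mu> {y \<in> A. floor_in R y = floor_in R x} \<le> 1 / real N"
    by (rule discrete_prob_on_net[OF A(2,1) N, folded m]) (rule that)
  obtain Q where Q: "Q \<subseteq> B" "card Q \<le> m" "\<And>x. x \<in> B \<Longrightarrow> \<exists>r\<in>Q. r \<le> x"
    "\<And>x. x \<in> B \<Longrightarrow> floor_in Q x \<noteq> x \<Longrightarrow>
       measure \<nu> {y \<in> B. floor_in Q y = floor_in Q x} \<le> 1 / real N"
    by (rule discrete_prob_on_net[OF B(2,1) N, folded m]) (rule that)
  have ne: "R \<noteq> {}" "Q \<noteq> {}" using R(3) Q(3) M.not_empty N.not_empty \<mu> \<nu> by auto
  have fin: "finite R" "finite Q" using A(1) B(1) R(1) Q(1) finite_subset by blast+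
  obtain c1 where c1: "set c1 = R" "length c1 = m" by (rule ex_list_of_length[OF fin(1) ne(1) R(2)])
  obtain c2 where c2: "set c2 = Q" "length c2 = m" by (rule ex_list_of_length[OF fin(2) ne(2) Q(2)])
  define d :: "real list"
    where "d = map (\<lambda>k. if (c1 ! (k div m), c2 ! (k mod m)) \<in> C then 1 else 0) [0..<m\<^sup>2]"
  let ?r = "floor_in R" and ?q = "floor_in Q"
  \<comment> \<open>The second coordinate is rounded first, then the first coordinate. Off
    \<open>E1\<close> and \<open>E2\<close> membership in \<open>C\<close> survives both moves, so
    the symmetric difference lies in their union.\<close>
  define E1 where "E1 = {(x, y) \<in> A \<times> B. ((x, y) \<in> C) \<noteq> ((x, ?q y) \<in> C)}"
  define E2 where "E2 = {(x, y) \<in> A \<times> B. ((x, ?q y) \<in> C) \<noteq> ((?r x, ?q y) \<in> C)}"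
  have sets: "S \<in> sets (\<mu> \<Otimes>\<^sub>M \<nu>)" if "S \<subseteq> A \<times> B" for S
    using sets_pair_discrete[OF A(2) B(2) A(1) B(1) that] .
  have E_sets: "E1 \<in> sets (\<mu> \<Otimes>\<^sub>M \<nu>)" "E2 \<in> sets (\<mu> \<Otimes>\<^sub>M \<nu>)"
    by (auto simp: E1_def E2_def intro!: sets)
  have E1: "measure (\<mu> \<Otimes>\<^sub>M \<nu>) E1 \<le> real D / real N"
  proof (rule measure_pair_le_of_slices[OF \<mu>(1) \<nu>(1) E_sets(1)])
    fix x assume "x \<in> space \<mu>"
    then have "Pair x -` E1 = {y \<in> B. ((x, y) \<in> C) \<noteq> ((x, ?q y) \<in> C)}"
      using \<mu> by (auto simp: E1_def)
    then show "measure \<nu> (Pair x -` E1) \<le> real D / real N"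
      using rounding_error_le[OF B(2,1) Q(1,3,4) no_alternating_sequence_vertical[OF bdd, of x]]
      by simp
  qed simp
  have E2: "measure (\<mu> \<Otimes>\<^sub>M \<nu>) E2 \<le> real D / real N"
  proof (rule measure_pair_le_of_slices2[OF \<mu>(1) \<nu>(1) E_sets(2)])
    fix y assume "y \<in> space \<nu>"
    then have "(\<lambda>x. (x, y)) -` E2 = {x \<in> A. ((x, ?q y) \<in> C) \<noteq> ((?r x, ?q y) \<in> C)}"
      using \<nu> by (auto simp: E2_def)
    \<comment> \<open>The first coordinate moves along the line at height \<open>?q y\<close>, since
      the second is already rounded.\<close>
    then show "measure \<mu> ((\<lambda>x. (x, y)) -` E2) \<le> real D / real N"
      using rounding_error_le[OF A(2,1) R(1,3,4) no_alternating_sequence_horizontal[OF bdd, of "?q y"]]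
      by simp
  qed simp
  let ?S = "sym_diff (defined_set (block_formula m) ((c1 @ c2) @ d) \<inter> A \<times> B) (C \<inter> A \<times> B)"
  have "(x, y) \<in> defined_set (block_formula m) ((c1 @ c2) @ d) \<longleftrightarrow> (?r x, ?q y) \<in> C"
    if "x \<in> A" "y \<in> B" for x y
    using defined_set_block_formula[OF c1(2) c2(2) d_def] R(3)[OF that(1)] Q(3)[OF that(2)] c1 c2
    by simp
  then have "?S \<subseteq> E1 \<union> E2" by (auto simp: E1_def E2_def)
  then have "measure (\<mu> \<Otimes>\<^sub>M \<nu>) ?S \<le> measure (\<mu> \<Otimes>\<^sub>M \<nu>) (E1 \<union> E2)"
    using E_sets by (intro P.P.finite_measure_mono) auto
  also have "\<dots> \<le> measure (\<mu> \<Otimes>\<^sub>M \<nu>) E1 + measure (\<mu> \<Otimes>\<^sub>M \<nu>) E2"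
    using E_sets by (rule measure_Un_le)
  also have "\<dots> \<le> 2 * real D / real N" using E1 E2 by simp
  finally have "measure (\<mu> \<Otimes>\<^sub>M \<nu>) ?S \<le> 2 * real D / real N" .
  moreover have "length (c1 @ c2) = 2 * m" "set (c1 @ c2) \<subseteq> A \<union> B" "length d = m\<^sup>2" "set d \<subseteq> {0, 1}"
    using c1 c2 R(1) Q(1) by (auto simp: d_def)
  ultimately show ?thesis by blast
qed

theorem theorem6p1:
  fixes \<epsilon> :: real and D :: nat
  assumes "\<epsilon> > 0"
  shows "\<exists>(m :: nat) (\<phi> :: or_formula).
    free_vars \<phi> \<subseteq> {..<2 + 2 * m + m\<^sup>2} \<and>
    (\<forall>\<C> :: (real \<times> real) set set. bounded_alternation D \<C> \<longrightarrow>
      (\<forall>C\<in>\<C>. \<forall>(n :: nat) (a :: nat \<Rightarrow> real) (b :: nat \<Rightarrow> real).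
        inj_on a {..<n} \<and> inj_on b {..<n} \<longrightarrow>
        (\<forall>(\<mu>0 :: real measure) (\<mu>1 :: real measure).
          discrete_prob_on (a ` {..<n}) \<mu>0 \<and> discrete_prob_on (b ` {..<n}) \<mu>1 \<longrightarrow>
          (\<exists>(c :: real list) (d :: real list).
            length c = 2 * m \<and> set c \<subseteq> fst ` grid n a b \<union> snd ` grid n a b \<and>
            length d = m\<^sup>2 \<and> set d \<subseteq> {0, 1} \<and>
            measure (\<mu>0 \<Otimes>\<^sub>M \<mu>1)
              (sym_diff (defined_set \<phi> (c @ d) \<inter> grid n a b) (C \<inter> grid n a b)) \<le> \<epsilon>))))"
proof -
  \<comment> \<open>This makes the total error \<open>2 * D / N\<close> at most \<epsilon>;
    \<open>Suc\<close> keeps \<open>N\<close> positive when \<open>D\<close> is 0.\<close>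
  define N where "N = Suc (nat \<lceil>2 * real D / \<epsilon>\<rceil>)"
  define m where "m = 2 * (N + 1)"
  have N: "N > 0" by (simp add: N_def)
  have "2 * real D / \<epsilon> \<le> real N" unfolding N_def by linarith
  then have "2 * real D / real N \<le> \<epsilon>" using assms N by (simp add: field_simps)
  note approx = order_trans[OF _ this]
  show ?thesis
  proof (intro exI[of _ m] exI[of _ "block_formula m"] conjI allI ballI impI free_vars_block_formula)
    fix \<C> :: "(real \<times> real) set set" and C and n :: nat and a b :: "nat \<Rightarrow> real" and \<mu>0 \<mu>1 :: "real measure"
    assume C: "bounded_alternation D \<C>" "C \<in> \<C>"
      and \<mu>: "discrete_prob_on (a ` {..<n}) \<mu>0 \<and> discrete_prob_on (b ` {..<n}) \<mu>1"
    have grid: "grid n a b = a ` {..<n} \<times> b ` {..<n}" by (auto simp: grid_def)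
    \<comment> \<open>An empty set carries no probability measure. Hence both sides of the grid are
      nonempty, and its projections recover them.\<close>
    have "n \<noteq> 0"
    proof
      assume "n = 0"
      then have "space \<mu>0 = {}" "prob_space \<mu>0" using \<mu> by (auto simp: discrete_prob_on_def)
      then show False using prob_space.not_empty by blast
    qed
    then have coords: "fst ` grid n a b \<union> snd ` grid n a b = a ` {..<n} \<union> b ` {..<n}"
      by (auto simp: grid)
    show "\<exists>(c :: real list) (d :: real list).
            length c = 2 * m \<and> set c \<subseteq> fst ` grid n a b \<union> snd ` grid n a b \<and>
            length d = m\<^sup>2 \<and> set d \<subseteq> {0, 1} \<and>
            measure (\<mu>0 \<Otimes>\<^sub>M \<mu>1)
              (sym_diff (defined_set (block_formula m) (c @ d) \<inter> grid n a b) (C \<inter> grid n a b)) \<le> \<epsilon>"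
      using block_formula_approximates[OF C _ conjunct1[OF \<mu>] _ conjunct2[OF \<mu>] N m_def] approx
      unfolding coords unfolding grid by blast
  qed
qed

end
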